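(* On the relative boundary of the set of bimatrix games with a unique correlated equilibrium there are games with a continuum of Nash equilibria, games with a finite number greater than $1$ of Nash equilibria, and games with a unique Nash equilibrium. That is, for each of the following three properties there exist a size $m_1\times m_2$ and a bimatrix game $G$ of this size with the property, such that $G$ does not have a unique correlated equilibrium but is a limit of bimatrix games of size $m_1\times m_2$ having a unique correlated equilibrium: (a) $G$ has a continuum of Nash equilibria; (b) $G$ has a finite number, greater than $1$, of Nash equilibria; (c) $G$ has a unique Nash equilibrium.
   Context: A bimatrix game of size $m_1\times m_2$ is a two-player game with pure strategy sets $S^1,S^2$ of cardinalities $m_1,m_2$ ($\geq 1$; a one-person game is regarded as a bimatrix game in which the other player has a single strategy) and utility functions $U^1,U^2:S^1\times S^2\to\mathbb{R}$; it is identified with a point of $(\mathbb{R}^{m_1m_2})^2$ with the usual topology. Nash equilibria are taken in mixed strategies. A correlated equilibrium is a probability distribution $\mu$ on $S^1\times S^2$ such that for all $k,k'\in S^1$, $\sum_{l\in S^2}\mu(k,l)[U^1(k,l)-U^1(k',l)]\ge0$, and for all $l,l'\in S^2$, $\sum_{k\in S^1}\mu(k,l)[U^2(k,l)-U^2(k,l')]\ge0$. The set of games of size $m_1\times m_2$ with a unique correlated equilibrium is open, so its boundary points are the limits of games in the set that are not themselves in the set. *)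

theory Defs
  imports "HOL-Probability.Probability"
begin

text \<open>
  In a game of size \<open>m1 \<times> m2\<close> the pure strategy sets are \<open>{..<m1}\<close> and \<open>{..<m2}\<close>.
  The topological space below has as its points the pairs of utility functions that are
  extensional on \<open>{..<m1} \<times> {..<m2}\<close>, so each game is represented exactly once.
\<close>

type_synonym bimatrix_game = "(nat \<times> nat \<Rightarrow> real) \<times> (nat \<times> nat \<Rightarrow> real)"

definition game_space :: "nat \<Rightarrow> nat \<Rightarrow> bimatrix_game topology" where
  "game_space m1 m2 =
     prod_topology (powertop_real ({..<m1} \<times> {..<m2})) (powertop_real ({..<m1} \<times> {..<m2}))"

definition mixed_strategies :: "nat \<Rightarrow> nat pmf set" where
  "mixed_strategies m = {x. set_pmf x \<subseteq> {..<m}}"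

definition expected_utility :: "(nat \<times> nat \<Rightarrow> real) \<Rightarrow> nat pmf \<Rightarrow> nat pmf \<Rightarrow> real" where
  "expected_utility U x y = measure_pmf.expectation (pair_pmf x y) U"

definition nash_equilibria :: "nat \<Rightarrow> nat \<Rightarrow> bimatrix_game \<Rightarrow> (nat pmf \<times> nat pmf) set" where
  "nash_equilibria m1 m2 G =
     {(x, y). x \<in> mixed_strategies m1 \<and> y \<in> mixed_strategies m2 \<and>
        (\<forall>x' \<in> mixed_strategies m1. expected_utility (fst G) x' y \<le> expected_utility (fst G) x y) \<and>
        (\<forall>y' \<in> mixed_strategies m2. expected_utility (snd G) x y' \<le> expected_utility (snd G) x y)}"

definition correlated_equilibria :: "nat \<Rightarrow> nat \<Rightarrow> bimatrix_game \<Rightarrow> (nat \<times> nat) pmf set" where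
  "correlated_equilibria m1 m2 G =
     {\<mu>. set_pmf \<mu> \<subseteq> {..<m1} \<times> {..<m2} \<and>
        (\<forall>k<m1. \<forall>k'<m1. 0 \<le> (\<Sum>l<m2. pmf \<mu> (k, l) * (fst G (k, l) - fst G (k', l)))) \<and>
        (\<forall>l<m2. \<forall>l'<m2. 0 \<le> (\<Sum>k<m1. pmf \<mu> (k, l) * (snd G (k, l) - snd G (k, l'))))}"

definition unique_CE_games :: "nat \<Rightarrow> nat \<Rightarrow> bimatrix_game set" where
  "unique_CE_games m1 m2 =
     {G \<in> topspace (game_space m1 m2). \<exists>!\<mu>. \<mu> \<in> correlated_equilibria m1 m2 G}"

text \<open>
  Since the set of games with a unique correlated equilibrium is open in the space of games of
  its size, its relative boundary consists of the limits of games in the set that are not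
  themselves in the set.
\<close>

definition unique_CE_boundary :: "nat \<Rightarrow> nat \<Rightarrow> bimatrix_game set" where
  "unique_CE_boundary m1 m2 =
     {G \<in> topspace (game_space m1 m2). G \<notin> unique_CE_games m1 m2 \<and>
        (\<exists>H. (\<forall>n. H n \<in> unique_CE_games m1 m2) \<and> limitin (game_space m1 m2) H G sequentially)}"

end

theory Submission
  imports Defs
begin

text \<open>
  In each case the game is a limit, as \<open>a\<close> decreases to \<open>0\<close>, of games with a unique correlated
  equilibrium. For a continuum and for two Nash equilibria, strict dominance gives uniqueness
  for \<open>a > 0\<close> and is lost in the limit. For a unique Nash equilibrium, take Rock-Paper-Scissors with
  payoff \<open>1\<close> for a win and \<open>-a\<close> for a loss. Summing the incentive constraints
  for the deviations \<open>k \<rightarrow> k + 1\<close> gives \<open>-d \<ge> 0\<close>, and summing those for \<open>k \<rightarrow> k + 2\<close> gives \<open>a d \<ge> 0\<close>, where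
  \<open>d\<close> is a difference of diagonal and off-diagonal weights. If \<open>a > 0\<close>, every constraint is therefore
  tight, which forces the uniform distribution. The limit \<open>a = 0\<close> is Shapley's game, in which the
  uniform distribution on the off-diagonal cells is a second correlated equilibrium.
\<close>

section \<open>Games given by utility tables, and a criterion for lying on the boundary\<close>

definition game :: "nat \<Rightarrow> nat \<Rightarrow> (nat \<times> nat \<Rightarrow> real) \<Rightarrow> (nat \<times> nat \<Rightarrow> real) \<Rightarrow> bimatrix_game" where
  "game m1 m2 U V = (restrict U ({..<m1} \<times> {..<m2}), restrict V ({..<m1} \<times> {..<m2}))"

lemma game_in_game_space: "game m1 m2 U V \<in> topspace (game_space m1 m2)"
  by (simp add: game_def game_space_def)

lemma limitin_game:
  assumes "\<And>k l. k < m1 \<Longrightarrow> l < m2 \<Longrightarrow> (\<lambda>n. Us n (k, l)) \<longlonglongrightarrow> U (k, l)"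
    and "\<And>k l. k < m1 \<Longrightarrow> l < m2 \<Longrightarrow> (\<lambda>n. Vs n (k, l)) \<longlonglongrightarrow> V (k, l)"
  shows "limitin (game_space m1 m2) (\<lambda>n. game m1 m2 (Us n) (Vs n)) (game m1 m2 U V) sequentially"
  using assms
  by (auto simp: game_space_def game_def limitin_pairwise limitin_componentwise o_def)

lemma correlated_equilibria_game_iff:
  "\<mu> \<in> correlated_equilibria m1 m2 (game m1 m2 U V) \<longleftrightarrow>
     set_pmf \<mu> \<subseteq> {..<m1} \<times> {..<m2} \<and>
     (\<forall>k<m1. \<forall>k'<m1. 0 \<le> (\<Sum>l<m2. pmf \<mu> (k, l) * (U (k, l) - U (k', l)))) \<and>
     (\<forall>l<m2. \<forall>l'<m2. 0 \<le> (\<Sum>k<m1. pmf \<mu> (k, l) * (V (k, l) - V (k, l'))))"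
  by (simp add: correlated_equilibria_def game_def cong: conj_cong)

lemma correlated_equilibria_gameD:
  assumes "\<mu> \<in> correlated_equilibria m1 m2 (game m1 m2 U V)"
  shows "set_pmf \<mu> \<subseteq> {..<m1} \<times> {..<m2}"
    and "k < m1 \<Longrightarrow> k' < m1 \<Longrightarrow> 0 \<le> (\<Sum>l<m2. pmf \<mu> (k, l) * (U (k, l) - U (k', l)))"
    and "l < m2 \<Longrightarrow> l' < m2 \<Longrightarrow> 0 \<le> (\<Sum>k<m1. pmf \<mu> (k, l) * (V (k, l) - V (k, l')))"
  using assms unfolding correlated_equilibria_game_iff by simp_all

text \<open>All three examples have this form: a payoff family continuous in \<open>a\<close> at 0,
  with uniqueness for \<open>a > 0\<close> and two distinct correlated equilibria at
  \<open>a = 0\<close>.\<close>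

lemma unique_CE_boundaryI:
  fixes U V :: "real \<Rightarrow> nat \<times> nat \<Rightarrow> real"
  assumes unique: "\<And>a. a > 0 \<Longrightarrow> \<exists>!\<mu>. \<mu> \<in> correlated_equilibria m1 m2 (game m1 m2 (U a) (V a))"
    and \<mu>: "\<mu> \<in> correlated_equilibria m1 m2 (game m1 m2 (U 0) (V 0))"
    and \<nu>: "\<nu> \<in> correlated_equilibria m1 m2 (game m1 m2 (U 0) (V 0))"
    and ne: "\<mu> \<noteq> \<nu>"
    and U: "\<And>k l. isCont (\<lambda>a. U a (k, l)) 0"
    and V: "\<And>k l. isCont (\<lambda>a. V a (k, l)) 0"
  shows "game m1 m2 (U 0) (V 0) \<in> unique_CE_boundary m1 m2"
proof -
  define a where "a n = 1 / real (Suc n)" for n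
  have "a \<longlonglongrightarrow> 0"
    unfolding a_def using LIMSEQ_Suc[OF lim_1_over_n] .
  then have "limitin (game_space m1 m2) (\<lambda>n. game m1 m2 (U (a n)) (V (a n))) (game m1 m2 (U 0) (V 0)) sequentially"
    by (intro limitin_game isCont_tendsto_compose[OF U] isCont_tendsto_compose[OF V])
  moreover have "\<forall>n. game m1 m2 (U (a n)) (V (a n)) \<in> unique_CE_games m1 m2"
    using unique game_in_game_space by (simp add: unique_CE_games_def a_def)
  moreover have "game m1 m2 (U 0) (V 0) \<notin> unique_CE_games m1 m2"
    using \<mu> \<nu> ne by (auto simp: unique_CE_games_def)
  ultimately show ?thesis
    unfolding unique_CE_boundary_def by (auto intro!: game_in_game_space)
qed

section \<open>Best replies and Nash equilibria in terms of supports\<close>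

lemma best_reply_iff:
  fixes u :: "nat \<Rightarrow> real"
  assumes x: "x \<in> mixed_strategies m"
  shows "(\<forall>x' \<in> mixed_strategies m. measure_pmf.expectation x' u \<le> measure_pmf.expectation x u) \<longleftrightarrow>
    (\<forall>i \<in> set_pmf x. \<forall>k<m. u k \<le> u i)"
proof -
  let ?E = "\<lambda>x. measure_pmf.expectation x u"
  have fin: "finite (set_pmf x')" if "x' \<in> mixed_strategies m" for x'
    using that by (auto simp: mixed_strategies_def intro: finite_subset)
  have lt: "i < m" if "x' \<in> mixed_strategies m" "i \<in> set_pmf x'" for x' i
    using that by (auto simp: mixed_strategies_def)
  show ?thesis
  proof
    assume best: "\<forall>x' \<in> mixed_strategies m. ?E x' \<le> ?E x"
    have le: "u k \<le> ?E x" if "k < m" for k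
      using best[rule_format, of "return_pmf k"] that by (simp add: mixed_strategies_def)
    \<comment> \<open>The shortfalls \<open>?E x - u i\<close> average to zero under
      \<open>x\<close> and none is negative, so each vanishes on the support.\<close>
    have "(\<Sum>i\<in>set_pmf x. pmf x i * (?E x - u i)) = 0"
      using integral_measure_pmf_real[OF fin[OF x], of x u] sum_pmf_eq_1[OF fin[OF x] order_refl]
      by (simp add: right_diff_distrib sum_subtractf flip: sum_distrib_right)
         (simp add: mult.commute)
    moreover have "0 \<le> pmf x i * (?E x - u i)" if "i \<in> set_pmf x" for i
      using le[OF lt[OF x that]] by simp
    ultimately have "pmf x i * (?E x - u i) = 0" if "i \<in> set_pmf x" for i
      using sum_nonneg_eq_0_iff[OF fin[OF x], of "\<lambda>i. pmf x i * (?E x - u i)"] that by simp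
    then have "u i = ?E x" if "i \<in> set_pmf x" for i
      using that by (fastforce simp: set_pmf_iff)
    then show "\<forall>i \<in> set_pmf x. \<forall>k<m. u k \<le> u i"
      using le by simp
  next
    assume supp: "\<forall>i \<in> set_pmf x. \<forall>k<m. u k \<le> u i"
    obtain i where i: "i \<in> set_pmf x" using set_pmf_not_empty[of x] by blast
    have "u j = u i" if "j \<in> set_pmf x" for j
      using supp i that lt[OF x] by (meson antisym)
    then have "?E x = measure_pmf.expectation x (\<lambda>_. u i)"
      by (intro integral_cong_AE) (auto simp: AE_measure_pmf_iff)
    moreover have "?E x' \<le> u i" if x': "x' \<in> mixed_strategies m" for x'
      using supp i lt[OF x']
      by (intro measure_pmf.integral_le_const integrable_measure_pmf_finite fin[OF x'])
         (auto simp: AE_measure_pmf_iff)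
    ultimately show "\<forall>x' \<in> mixed_strategies m. ?E x' \<le> ?E x"
      by simp
  qed
qed

lemma expected_utility_sum:
  assumes "x \<in> mixed_strategies m1" "y \<in> mixed_strategies m2"
  shows "expected_utility U x y = (\<Sum>k<m1. \<Sum>l<m2. pmf x k * pmf y l * U (k, l))"
proof -
  have "expected_utility U x y = (\<Sum>p\<in>{..<m1} \<times> {..<m2}. U p * pmf (pair_pmf x y) p)"
    unfolding expected_utility_def using assms
    by (intro integral_measure_pmf_real) (auto simp: mixed_strategies_def)
  then show ?thesis
    by (simp add: sum.cartesian_product case_prod_beta pmf_pair mult.commute
        flip: pmf_pair)
qed

lemma expectation_mixed_strategies:
  fixes u :: "nat \<Rightarrow> real"
  assumes "x \<in> mixed_strategies m"
  shows "measure_pmf.expectation x u = (\<Sum>k<m. pmf x k * u k)"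
  using assms integral_measure_pmf_real[of "{..<m}" x u]
  by (force simp: mixed_strategies_def mult.commute)

text \<open>Against a fixed opponent, expected utility is the expectation of a function of one's own
  pure strategy, so \<open>best_reply_iff\<close> applies to each player separately.\<close>

lemma nash_equilibria_game_iff:
  "(x, y) \<in> nash_equilibria m1 m2 (game m1 m2 U V) \<longleftrightarrow>
     x \<in> mixed_strategies m1 \<and> y \<in> mixed_strategies m2 \<and>
     (\<forall>i\<in>set_pmf x. \<forall>k<m1. (\<Sum>l<m2. pmf y l * U (k, l)) \<le> (\<Sum>l<m2. pmf y l * U (i, l))) \<and>
     (\<forall>j\<in>set_pmf y. \<forall>l<m2. (\<Sum>k<m1. pmf x k * V (k, l)) \<le> (\<Sum>k<m1. pmf x k * V (k, j)))"
proof (cases "x \<in> mixed_strategies m1 \<and> y \<in> mixed_strategies m2")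
  case True
  then have x: "x \<in> mixed_strategies m1" and y: "y \<in> mixed_strategies m2" by auto
  have 1: "expected_utility (fst (game m1 m2 U V)) x' y =
      measure_pmf.expectation x' (\<lambda>k. \<Sum>l<m2. pmf y l * U (k, l))"
    if "x' \<in> mixed_strategies m1" for x'
    using that y by (simp add: expected_utility_sum expectation_mixed_strategies game_def
        sum_distrib_left mult.assoc)
  have 2: "expected_utility (snd (game m1 m2 U V)) x y' =
      measure_pmf.expectation y' (\<lambda>l. \<Sum>k<m1. pmf x k * V (k, l))"
    if "y' \<in> mixed_strategies m2" for y'
    unfolding expected_utility_sum[OF x that] using that
    by (subst sum.swap) (simp add: expectation_mixed_strategies game_def
        sum_distrib_left mult.assoc mult.left_commute)
  show ?thesis
    using x y best_reply_iff[OF x, of "\<lambda>k. \<Sum>l<m2. pmf y l * U (k, l)"]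
      best_reply_iff[OF y, of "\<lambda>l. \<Sum>k<m1. pmf x k * V (k, l)"]
    by (simp add: nash_equilibria_def 1 2)
qed (auto simp: nash_equilibria_def)

lemma in_mixed_strategies_eqI:
  assumes "x \<in> mixed_strategies m" "y \<in> mixed_strategies m" "\<And>k. k < m \<Longrightarrow> pmf x k = pmf y k"
  shows "x = y"
proof (rule pmf_eqI)
  fix k show "pmf x k = pmf y k"
  proof (cases "k < m")
    case False
    then have "k \<notin> set_pmf x" "k \<notin> set_pmf y"
      using assms(1,2) by (auto simp: mixed_strategies_def)
    then show ?thesis by (simp add: set_pmf_iff)
  qed (fact assms(3))
qed

lemma sum_pmf_mixed_strategies:
  "x \<in> mixed_strategies m \<Longrightarrow> (\<Sum>k<m. pmf x k) = 1"
  by (auto simp: mixed_strategies_def intro: sum_pmf_eq_1)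

text \<open>The hypotheses describe a pure Nash equilibrium. Every correlated equilibrium exhibited
  in the first two examples arises in this way.\<close>

lemma return_pmf_in_correlated_equilibria_game:
  assumes "k0 < m1" "l0 < m2" "\<And>k. k < m1 \<Longrightarrow> U (k, l0) \<le> U (k0, l0)"
    and "\<And>l. l < m2 \<Longrightarrow> V (k0, l) \<le> V (k0, l0)"
  shows "return_pmf (k0, l0) \<in> correlated_equilibria m1 m2 (game m1 m2 U V)"
  using assms by (auto simp: correlated_equilibria_game_iff indicator_def intro!: sum_nonneg)

lemma isCont_If_const:
  assumes "c \<Longrightarrow> isCont f x" "\<not> c \<Longrightarrow> isCont g x"
  shows "isCont (\<lambda>a. if c then f a else g a) x"
  using assms by (cases c) auto

subsection \<open>A continuum of Nash equilibria\<close>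

lemma mixed_strategies_1: "mixed_strategies 1 = {return_pmf 0}"
  using set_pmf_subset_singleton[of _ "0::nat"] by (auto simp: mixed_strategies_def lessThan_Suc)

text \<open>The weight of strategy 0 is a coordinate; its inverse is a Bernoulli distribution
  relabelled to \<open>{0, 1}\<close>.\<close>

lemma mixed_strategies_2_eqpoll: "mixed_strategies 2 \<approx> {0..1::real}"
  unfolding eqpoll_def
proof (intro exI bij_betwI)
  show "(\<lambda>x. pmf x 0) \<in> mixed_strategies 2 \<rightarrow> {0..1}"
    by (simp add: pmf_le_1)
  define f where "f = (\<lambda>p. map_pmf (\<lambda>b. if b then 0 else 1::nat) (bernoulli_pmf p))"
  show mem: "f \<in> {0..1} \<rightarrow> mixed_strategies 2"
    by (auto simp: f_def mixed_strategies_def)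
  show pmf_f: "pmf (f p) 0 = p" if "p \<in> {0..1}" for p
    using that pmf_map_inj'[of "\<lambda>b. if b then 0 else 1::nat" "bernoulli_pmf p" True]
    by (auto simp: f_def inj_on_def split: if_splits)
  show "f (pmf x 0) = x" if x: "x \<in> mixed_strategies 2" for x
  proof (rule in_mixed_strategies_eqI[OF _ x])
    have p: "pmf x 0 \<in> {0..1}" by (simp add: pmf_le_1)
    then show fx: "f (pmf x 0) \<in> mixed_strategies 2" using mem by blast
    fix k :: nat assume "k < 2"
    then have "k = 0 \<or> k = 1" by auto
    then show "pmf (f (pmf x 0)) k = pmf x k"
      using pmf_f[OF p] sum_pmf_mixed_strategies[OF fx] sum_pmf_mixed_strategies[OF x]
      by (auto simp: numeral_2_eq_2)
  qed
qed

text \<open>The second player is a dummy. The first earns \<open>a\<close> for strategy 0 and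
  nothing for strategy 1, so 0 is strictly dominant for \<open>a > 0\<close>, while at
  \<open>a = 0\<close> every mixed strategy is optimal.\<close>

lemma ex_boundary_continuum_NE:
  "\<exists>G \<in> unique_CE_boundary 2 1. nash_equilibria 2 1 G \<approx> (UNIV :: real set)"
proof
  let ?U = "\<lambda>a p. if p = (0, 0) then a else 0::real" and ?V = "\<lambda>_. 0::real"
  show "game 2 1 (?U 0) ?V \<in> unique_CE_boundary 2 1"
  proof (rule unique_CE_boundaryI[where U = ?U and V = "\<lambda>_. ?V"])
    fix a :: real assume a: "a > 0"
    show "\<exists>!\<mu>. \<mu> \<in> correlated_equilibria 2 1 (game 2 1 (?U a) ?V)"
    proof
      show "return_pmf (0, 0) \<in> correlated_equilibria 2 1 (game 2 1 (?U a) ?V)"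
        using a by (intro return_pmf_in_correlated_equilibria_game) auto
      fix \<mu> assume \<mu>: "\<mu> \<in> correlated_equilibria 2 1 (game 2 1 (?U a) ?V)"
      note row = correlated_equilibria_gameD(2)[OF \<mu>]
      have "pmf \<mu> (1, 0) * a \<le> 0" using row[of 1 0] by simp
      then have "pmf \<mu> (1, 0) \<le> 0" using a by (simp add: mult_le_0_iff)
      then have "pmf \<mu> (1, 0) = 0" by simp
      then have "set_pmf \<mu> \<subseteq> {(0, 0)}"
        using correlated_equilibria_gameD(1)[OF \<mu>]
        by (auto simp: set_pmf_iff less_2_cases_iff dest!: subsetD)
      then show "\<mu> = return_pmf (0, 0)" by (simp add: set_pmf_subset_singleton)
    qed
  next
    show "return_pmf (0, 0) \<in> correlated_equilibria 2 1 (game 2 1 (?U 0) ?V)"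
      and "return_pmf (1, 0) \<in> correlated_equilibria 2 1 (game 2 1 (?U 0) ?V)"
      by (rule return_pmf_in_correlated_equilibria_game; simp)+
  qed (auto intro!: isCont_If_const)
  have "nash_equilibria 2 1 (game 2 1 (?U 0) ?V) = mixed_strategies 2 \<times> {return_pmf 0}"
    by (auto simp: nash_equilibria_game_iff mixed_strategies_1[simplified])
  also have "\<dots> \<approx> mixed_strategies 2"
    by (rule eqpoll_trans[OF times_commute_eqpoll times_singleton_eqpoll])
  also have "\<dots> \<approx> {0..1::real}" by (rule mixed_strategies_2_eqpoll)
  also have "\<dots> \<approx> (UNIV :: real set)"
    by (rule eqpoll_real_subset[of 0 1]) auto
  finally show "nash_equilibria 2 1 (game 2 1 (?U 0) ?V) \<approx> (UNIV :: real set)" .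
qed

subsection \<open>Two Nash equilibria\<close>

text \<open>For \<open>a > 0\<close> row 0 strictly dominates row 1, and column 0 is the strict best
  reply to row 0. At \<open>a = 0\<close> all payoffs outside \<open>(0, 0)\<close> are 0, and no
  unilateral deviation from \<open>(1, 1)\<close> reaches \<open>(0, 0)\<close>, so
  \<open>(1, 1)\<close> is an equilibrium too.\<close>

lemma ex_boundary_two_NE:
  "\<exists>G \<in> unique_CE_boundary 2 2. finite (nash_equilibria 2 2 G) \<and> card (nash_equilibria 2 2 G) > 1"
proof
  let ?U = "\<lambda>a p. if p = (0, 0) then 1 else if p = (0, 1) then a else 0::real"
    and ?V = "\<lambda>p. if p = (0, 0) then 1 else 0::real"
  show "game 2 2 (?U 0) ?V \<in> unique_CE_boundary 2 2"
  proof (rule unique_CE_boundaryI[where U = ?U and V = "\<lambda>_. ?V"])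
    fix a :: real assume a: "a > 0"
    show "\<exists>!\<mu>. \<mu> \<in> correlated_equilibria 2 2 (game 2 2 (?U a) ?V)"
    proof
      show "return_pmf (0, 0) \<in> correlated_equilibria 2 2 (game 2 2 (?U a) ?V)"
        using a by (intro return_pmf_in_correlated_equilibria_game) auto
      fix \<mu> assume \<mu>: "\<mu> \<in> correlated_equilibria 2 2 (game 2 2 (?U a) ?V)"
      note row = correlated_equilibria_gameD(2)[OF \<mu>] and col = correlated_equilibria_gameD(3)[OF \<mu>]
      have "0 \<le> - pmf \<mu> (1, 0) - pmf \<mu> (1, 1) * a"
        using row[of 1 0] by (simp add: numeral_2_eq_2)
      moreover have "0 \<le> pmf \<mu> (1, 1) * a" using a by simp
      ultimately have z1: "pmf \<mu> (1, 0) = 0" "pmf \<mu> (1, 1) * a = 0"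
        using pmf_nonneg[of \<mu> "(1, 0)"] by linarith+
      \<comment> \<open>Strict positivity of \<open>a\<close> is what empties this cell, which
        carries the second equilibrium in the limit.\<close>
      then have z: "pmf \<mu> (1, 1) = 0" using a by simp
      have "0 \<le> - pmf \<mu> (0, 1)"
        using col[of 1 0] by (simp add: numeral_2_eq_2)
      then have "pmf \<mu> (0, 1) = 0" using pmf_nonneg[of \<mu> "(0, 1)"] by linarith
      with z1 z have "set_pmf \<mu> \<subseteq> {(0, 0)}"
        using correlated_equilibria_gameD(1)[OF \<mu>]
        by (auto simp: set_pmf_iff less_2_cases_iff dest!: subsetD)
      then show "\<mu> = return_pmf (0, 0)" by (simp add: set_pmf_subset_singleton)
    qed
  next
    show "return_pmf (0, 0) \<in> correlated_equilibria 2 2 (game 2 2 (?U 0) ?V)"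
      and "return_pmf (1, 1) \<in> correlated_equilibria 2 2 (game 2 2 (?U 0) ?V)"
      by (rule return_pmf_in_correlated_equilibria_game; simp)+
  qed (auto intro!: isCont_If_const)
  have "nash_equilibria 2 2 (game 2 2 (?U 0) ?V) =
      {(return_pmf 0, return_pmf 0), (return_pmf 1, return_pmf 1)}"
  proof (intro equalityI subsetI)
    fix p assume p: "p \<in> nash_equilibria 2 2 (game 2 2 (?U 0) ?V)"
    obtain x y where xy: "p = (x, y)" by (cases p)
    have x: "set_pmf x \<subseteq> {0, 1}" and y: "set_pmf y \<subseteq> {0, 1}"
      and row: "1 \<in> set_pmf x \<Longrightarrow> pmf y 0 \<le> 0" and col: "1 \<in> set_pmf y \<Longrightarrow> pmf x 0 \<le> 0"
      using p by (force simp: xy nash_equilibria_game_iff numeral_2_eq_2 mixed_strategies_def)+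
    \<comment> \<open>If row 1 is played, column 0 is not, so \<open>y\<close> is pure at 1 and row
      0 is not played either. Otherwise \<open>x\<close> is pure at 0, which rules out column
      1.\<close>
    then have "set_pmf x \<subseteq> {0} \<and> set_pmf y \<subseteq> {0} \<or> set_pmf x \<subseteq> {1} \<and> set_pmf y \<subseteq> {1}"
      using set_pmf_not_empty[of x] set_pmf_not_empty[of y] pmf_positive[of 0 x] pmf_positive[of 0 y]
      by force
    then show "p \<in> {(return_pmf 0, return_pmf 0), (return_pmf 1, return_pmf 1)}"
      by (auto simp: xy set_pmf_subset_singleton)
  qed (auto simp: nash_equilibria_game_iff mixed_strategies_def less_2_cases_iff numeral_2_eq_2)
  then show "finite (nash_equilibria 2 2 (game 2 2 (?U 0) ?V)) \<and>
      card (nash_equilibria 2 2 (game 2 2 (?U 0) ?V)) > 1"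
    by simp
qed

subsection \<open>A unique Nash equilibrium\<close>

text \<open>Each strategy beats its predecessor modulo 3. One's own strategy comes first and the
  opponent's second, hence the \<open>prod.swap\<close> for the second player.\<close>

definition rps :: "real \<Rightarrow> nat \<times> nat \<Rightarrow> real" where
  "rps a = (\<lambda>(k, l). if k = l then 0 else if k = Suc l mod 3 then 1 else - a)"

definition rps_game :: "real \<Rightarrow> bimatrix_game" where
  "rps_game a = game 3 3 (rps a) (rps a \<circ> prod.swap)"

lemma all_less_3: "(\<forall>k<3. P k) \<longleftrightarrow> P 0 \<and> P 1 \<and> P (2::nat)"
  by (auto simp: numeral_3_eq_3 numeral_2_eq_2 less_Suc_eq)

lemma sum_less_3: "sum f {..<3} = f 0 + f 1 + f (2::nat)" for f :: "nat \<Rightarrow> real"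
  by (simp add: numeral_3_eq_3 numeral_2_eq_2)

text \<open>The cyclic differences are \<open>e\<close>, \<open>a * e\<close> and
  \<open>a * a * e\<close>, and they sum to zero; the factor \<open>1 + a + a * a\<close> is
  positive.\<close>

lemma rps_indifferent:
  fixes a p q r :: real
  assumes a: "a > 0" and eq: "r - a * q = p - a * r" "p - a * r = q - a * p"
  shows "p = q \<and> q = r"
proof -
  define e where "e = q - r"
  have f: "r - p = a * e" and g: "p - q = a * (r - p)"
    using eq by (simp_all add: e_def algebra_simps)
  have "(1 + a + a * a) * e = e + a * e + a * (a * e)"
    by (simp add: algebra_simps)
  also have "\<dots> = 0"
    using f g by (simp add: e_def flip: f)
  finally have "(1 + a + a * a) * e = 0" .
  moreover have "1 + a + a * a > 0" using a by (simp add: add_pos_pos)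
  ultimately have "e = 0" by simp
  then show ?thesis using f e_def by simp
qed

text \<open>The weights \<open>f\<close> are not normalised, so a single row or column of a joint
  distribution can be inserted. Tightness makes the three pure payoffs against \<open>f\<close>
  equal.\<close>

lemma rps_indifferent_imp_uniform:
  assumes a: "a > 0" and k: "k < 3"
    and eq: "\<And>k'. k' < 3 \<Longrightarrow> (\<Sum>l<3. f l * (rps a (k, l) - rps a (k', l))) = 0"
  shows "f 0 = f 1 \<and> f 1 = f 2"
proof (rule rps_indifferent[OF a])
  define v where "v i = (\<Sum>l<3. f l * rps a (i, l))" for i
  have "v i = v k" if "i < 3" for i
    using eq[OF that] by (simp add: v_def right_diff_distrib sum_subtractf)
  then have "v 0 = v 1" "v 1 = v 2" by simp_all
  then show "f 2 - a * f 1 = f 0 - a * f 2" "f 0 - a * f 2 = f 1 - a * f 0"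
    by (simp_all add: v_def sum_less_3 rps_def mult.commute)
qed

lemma rps_CE_uniform:
  assumes a: "a > 0" and \<mu>: "\<mu> \<in> correlated_equilibria 3 3 (rps_game a)"
  shows "\<mu> = pmf_of_set ({..<3} \<times> {..<3})"
proof -
  define m where "m k l = pmf \<mu> (k, l)" for k l
  define R where "R k k' = (\<Sum>l<3. m k l * (rps a (k, l) - rps a (k', l)))" for k k'
  \<comment> \<open>The second player's swapped payoffs give \<open>C\<close> the shape of
    \<open>R\<close> with transposed weights, so one indifference lemma serves both.\<close>
  define C where "C l l' = (\<Sum>k<3. m k l * (rps a (l, k) - rps a (l', k)))" for l l'
  note expand = R_def C_def sum_less_3 rps_def
  note \<mu>' = correlated_equilibria_gameD[OF \<mu>[unfolded rps_game_def]]
  have set: "set_pmf \<mu> \<subseteq> {..<3} \<times> {..<3}"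
    by (rule \<mu>'(1))
  have R: "0 \<le> R k k'" if "k < 3" "k' < 3" for k k'
    using \<mu>'(2)[OF that] by (simp add: R_def m_def)
  have C: "0 \<le> C l l'" if "l < 3" "l' < 3" for l l'
    using \<mu>'(3)[OF that] by (simp add: C_def m_def)
  define d where "d = 2 * (m 0 0 + m 1 1 + m 2 2) - (m 0 1 + m 1 0 + m 0 2 + m 2 0 + m 1 2 + m 2 1)"
  \<comment> \<open>Row constraints alone give the off-diagonal cells the coefficients
    \<open>-a\<close> and \<open>1 + a\<close>; the column constraints exchange the two, so each
    such cell gets 1 in total and each diagonal cell -2. Below, the pair is \<open>1\<close> and
    \<open>-1 - a\<close>, with total \<open>-a\<close>, against \<open>2 * a\<close> on the
    diagonal.\<close>
  have up: "(R 0 1 + R 1 2 + R 2 0) + (C 0 1 + C 1 2 + C 2 0) = - d"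
    by (simp add: expand d_def algebra_simps)
  have down: "(R 0 2 + R 1 0 + R 2 1) + (C 0 2 + C 1 0 + C 2 1) = a * d"
    by (simp add: expand d_def algebra_simps)
  have nonneg: "0 \<le> R 0 1" "0 \<le> R 1 2" "0 \<le> R 2 0" "0 \<le> R 0 2" "0 \<le> R 1 0" "0 \<le> R 2 1"
    "0 \<le> C 0 1" "0 \<le> C 1 2" "0 \<le> C 2 0" "0 \<le> C 0 2" "0 \<le> C 1 0" "0 \<le> C 2 1"
    by (rule R C; simp)+
  have "0 \<le> a * d" "d \<le> 0" using up down nonneg by linarith+
  then have d: "d = 0" using a by (simp add: zero_le_mult_iff)
  have "a * d = 0" by (simp add: d)
  with d up down nonneg
  have tight: "R 0 1 = 0" "R 1 2 = 0" "R 2 0 = 0" "R 0 2 = 0" "R 1 0 = 0" "R 2 1 = 0"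
    "C 0 1 = 0" "C 1 2 = 0" "C 2 0 = 0" "C 0 2 = 0" "C 1 0 = 0" "C 2 1 = 0"
    by linarith+
  have "R k k = 0" "C k k = 0" for k by (simp_all add: R_def C_def)
  with tight have "\<forall>k<3. \<forall>k'<3. R k k' = 0" "\<forall>l<3. \<forall>l'<3. C l l' = 0"
    by (simp_all only: all_less_3 simp_thms)
  \<comment> \<open>Each row and each column of weights is constant, which links all nine
    cells.\<close>
  then have "m k 0 = m k 1 \<and> m k 1 = m k 2" "m 0 k = m 1 k \<and> m 1 k = m 2 k" if "k < 3" for k
    using rps_indifferent_imp_uniform[OF a that, of "m k"]
      rps_indifferent_imp_uniform[OF a that, of "\<lambda>i. m i k"] that
    unfolding R_def C_def by blast+
  then have const: "m k l = m 0 0" if "k < 3" "l < 3" for k l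
    using that by (auto simp: numeral_3_eq_3 numeral_2_eq_2 less_Suc_eq)
  have "(\<Sum>p\<in>{..<3} \<times> {..<3}. pmf \<mu> p) = 1"
    using set by (intro sum_pmf_eq_1) auto
  then have "(\<Sum>k<3. \<Sum>l<3. m k l) = 1"
    by (simp add: m_def sum.cartesian_product)
  moreover have "(\<Sum>k<3. \<Sum>l<3. m k l) = (\<Sum>k<3::nat. \<Sum>l<3::nat. m 0 0)"
    by (intro sum.cong refl const) auto
  ultimately have "m 0 0 = 1 / 9" by simp
  then have "pmf \<mu> (k, l) = pmf (pmf_of_set ({..<3} \<times> {..<3})) (k, l)" for k l
    using set const[of k l]
    by (auto simp: m_def indicator_def pmf_eq_0_set_pmf lessThan_empty_iff)
  then show ?thesis by (auto intro: pmf_eqI)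
qed

text \<open>Against uniform weights all three strategies earn the same, so every constraint is
  tight, for any \<open>a\<close>.\<close>

lemma uniform_in_correlated_equilibria_rps:
  "pmf_of_set ({..<3} \<times> {..<3}) \<in> correlated_equilibria 3 3 (rps_game a)"
  by (simp add: rps_game_def correlated_equilibria_game_iff lessThan_empty_iff all_less_3
      sum_less_3 rps_def add_divide_distrib diff_divide_distrib)

lemma off_diagonal_nonempty: "{..<3} \<times> {..<3} - Id \<noteq> ({} :: (nat \<times> nat) set)"
proof -
  have "(0, 1) \<in> {..<3} \<times> {..<3} - (Id :: (nat \<times> nat) set)" by simp
  then show ?thesis by blast
qed

text \<open>Given recommendation \<open>k\<close>, the opponent plays the two other strategies
  equally often. Following it wins half the time, as does deviating to the predecessor of
  \<open>k\<close>; deviating to the successor never wins.\<close>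

lemma off_diagonal_in_correlated_equilibria_rps_0:
  "pmf_of_set ({..<3} \<times> {..<3} - Id) \<in> correlated_equilibria 3 3 (rps_game 0)"
  using off_diagonal_nonempty
  by (simp add: rps_game_def correlated_equilibria_game_iff all_less_3 sum_less_3 rps_def)

lemma rps_game_0_in_unique_CE_boundary: "rps_game 0 \<in> unique_CE_boundary 3 3"
  unfolding rps_game_def
proof (rule unique_CE_boundaryI[where U = rps and V = "\<lambda>a. rps a \<circ> prod.swap"], fold rps_game_def)
  show "\<exists>!\<mu>. \<mu> \<in> correlated_equilibria 3 3 (rps_game a)" if "a > 0" for a
    using uniform_in_correlated_equilibria_rps rps_CE_uniform[OF that] by blast
  show "pmf_of_set ({..<3} \<times> {..<3}) \<in> correlated_equilibria 3 3 (rps_game 0)"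
    by (rule uniform_in_correlated_equilibria_rps)
  show "pmf_of_set ({..<3} \<times> {..<3} - Id) \<in> correlated_equilibria 3 3 (rps_game 0)"
    by (rule off_diagonal_in_correlated_equilibria_rps_0)
  \<comment> \<open>A diagonal cell tells the two distributions apart.\<close>
  have "(0, 0) \<in> set_pmf (pmf_of_set ({..<3} \<times> {..<3} :: (nat \<times> nat) set))"
    by (subst set_pmf_of_set) (auto simp: lessThan_empty_iff)
  moreover have "(0, 0) \<notin> set_pmf (pmf_of_set ({..<3} \<times> {..<3} - Id :: (nat \<times> nat) set))"
    using off_diagonal_nonempty by (subst set_pmf_of_set) auto
  ultimately show "pmf_of_set ({..<3} \<times> {..<3}) \<noteq> (pmf_of_set ({..<3} \<times> {..<3} - Id) :: (nat \<times> nat) pmf)"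
    by metis
  show "isCont (\<lambda>a. rps a (k, l)) 0" for k l
    by (auto simp: rps_def intro!: isCont_If_const)
  then show "isCont (\<lambda>a. (rps a \<circ> prod.swap) (k, l)) 0" for k l
    by simp
qed

section \<open>Nash equilibria of Shapley's game\<close>

lemma rps_0_payoff:
  assumes "k < 3"
  shows "(\<Sum>l<3. f l * rps 0 (k, l)) = f ((k + 2) mod 3)"
proof -
  have "\<forall>k<3. (\<Sum>l<3. f l * rps 0 (k, l)) = f ((k + 2) mod 3)"
    by (simp add: all_less_3 sum_less_3 rps_def numeral_2_eq_2)
  then show ?thesis using assms by blast
qed

text \<open>When losses cost nothing, \<open>i\<close> earns exactly the weight of the strategy it
  beats, \<open>(i + 2) mod 3\<close>; it is a best reply when that weight is maximal.\<close>

lemma nash_equilibria_rps_0_iff: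
  "(x, y) \<in> nash_equilibria 3 3 (rps_game 0) \<longleftrightarrow>
     x \<in> mixed_strategies 3 \<and> y \<in> mixed_strategies 3 \<and>
     (\<forall>i\<in>set_pmf x. \<forall>k<3. pmf y ((k + 2) mod 3) \<le> pmf y ((i + 2) mod 3)) \<and>
     (\<forall>j\<in>set_pmf y. \<forall>l<3. pmf x ((l + 2) mod 3) \<le> pmf x ((j + 2) mod 3))"
proof (cases "x \<in> mixed_strategies 3 \<and> y \<in> mixed_strategies 3")
  case True
  then have "i < 3" if "i \<in> set_pmf x \<or> i \<in> set_pmf y" for i
    using that by (auto simp: mixed_strategies_def)
  with True show ?thesis
    unfolding rps_game_def nash_equilibria_game_iff o_def prod.swap_def fst_conv snd_conv
    by (simp add: rps_0_payoff cong: ball_cong_simp)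
qed (auto simp: nash_equilibria_def)

text \<open>Playing \<open>i\<close> forces \<open>(i + 2) mod 3\<close> to be a most likely
  strategy of the opponent, hence played in turn. Once all strategies are most likely ones, both
  distributions are uniform.\<close>

lemma ex1_NE_rps_game_0: "\<exists>!\<sigma>. \<sigma> \<in> nash_equilibria 3 3 (rps_game 0)"
proof
  let ?u = "pmf_of_set {..<3::nat}"
  have supp: "set_pmf ?u = {..<3}"
    by (simp add: lessThan_empty_iff)
  then have u: "?u \<in> mixed_strategies 3"
    by (simp add: mixed_strategies_def)
  then show "(?u, ?u) \<in> nash_equilibria 3 3 (rps_game 0)"
    by (simp add: nash_equilibria_rps_0_iff lessThan_empty_iff)
  fix \<sigma> assume \<sigma>: "\<sigma> \<in> nash_equilibria 3 3 (rps_game 0)"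
  obtain x y where xy: "\<sigma> = (x, y)" by (cases \<sigma>)
  have x: "x \<in> mixed_strategies 3" and y: "y \<in> mixed_strategies 3"
    and row: "\<forall>i\<in>set_pmf x. \<forall>k<3. pmf y ((k + 2) mod 3) \<le> pmf y ((i + 2) mod 3)"
    and col: "\<forall>j\<in>set_pmf y. \<forall>l<3. pmf x ((l + 2) mod 3) \<le> pmf x ((j + 2) mod 3)"
    using \<sigma> unfolding xy nash_equilibria_rps_0_iff by blast+
  define P where "P z i \<longleftrightarrow> (\<forall>k<3. pmf z k \<le> pmf z i)" for z :: "nat pmf" and i
  \<comment> \<open>The shift by 2 permutes the three strategies, so maximality over shifted indices
    is maximality over all.\<close>
  have best: "P z ((i + 2) mod 3)" if "\<forall>k<3. pmf z ((k + 2) mod 3) \<le> pmf z ((i + 2) mod 3)" for z i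
    using that by (auto simp: P_def all_less_3 numeral_2_eq_2)
  have row': "pmf x i > 0 \<Longrightarrow> P y ((i + 2) mod 3)" for i
    using row best unfolding pmf_positive_iff by blast
  have col': "pmf y i > 0 \<Longrightarrow> P x ((i + 2) mod 3)" for i
    using col best unfolding pmf_positive_iff by blast
  \<comment> \<open>The three weights sum to 1, so a maximal one is not zero.\<close>
  have pos: "P z i \<Longrightarrow> pmf z i > 0" if z: "z \<in> mixed_strategies 3" for z i
    using sum_pmf_mixed_strategies[OF z] by (simp add: P_def all_less_3 sum_less_3)
  have x1: "pmf x 0 + pmf x 1 + pmf x 2 = 1" and y1: "pmf y 0 + pmf y 1 + pmf y 2 = 1"
    using sum_pmf_mixed_strategies[OF x] sum_pmf_mixed_strategies[OF y] by (simp_all add: sum_less_3)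
  have "pmf x 0 > 0 \<or> pmf x 1 > 0 \<or> pmf x 2 > 0"
    using x1 by linarith
  \<comment> \<open>The best-reply cycle runs through all six pure strategies, so every one of them is played.\<close>
  then have "P x 0 \<and> P x 1 \<and> P x 2 \<and> P y 0 \<and> P y 1 \<and> P y 2"
    using row'[of 0] row'[of 1] row'[of 2] col'[of 0] col'[of 1] col'[of 2]
      pos[OF x, of 0] pos[OF x, of 1] pos[OF x, of 2] pos[OF y, of 0] pos[OF y, of 1] pos[OF y, of 2]
    by (simp add: numeral_2_eq_2) argo
  then have "\<forall>k<3. pmf x k = 1 / 3 \<and> pmf y k = 1 / 3"
    using x1 y1 by (auto simp: P_def all_less_3)
  then have "x = ?u" "y = ?u"
    using x y u by (auto intro!: in_mixed_strategies_eqI[where m = 3] simp: lessThan_empty_iff)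
  then show "\<sigma> = (?u, ?u)" using xy by simp
qed

theorem mainTheorem9:
  shows "(\<exists>m1\<ge>1. \<exists>m2\<ge>1. \<exists>G \<in> unique_CE_boundary m1 m2.
            nash_equilibria m1 m2 G \<approx> (UNIV :: real set)) \<and>
         (\<exists>m1\<ge>1. \<exists>m2\<ge>1. \<exists>G \<in> unique_CE_boundary m1 m2.
            finite (nash_equilibria m1 m2 G) \<and> card (nash_equilibria m1 m2 G) > 1) \<and>
         (\<exists>m1\<ge>1. \<exists>m2\<ge>1. \<exists>G \<in> unique_CE_boundary m1 m2.
            \<exists>!\<sigma>. \<sigma> \<in> nash_equilibria m1 m2 G)"
proof (intro conjI)
  have "(1::nat) \<le> 1" "(1::nat) \<le> 2" "(1::nat) \<le> 3" by simp_all
  then show "\<exists>m1\<ge>1. \<exists>m2\<ge>1. \<exists>G \<in> unique_CE_boundary m1 m2.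
      nash_equilibria m1 m2 G \<approx> (UNIV :: real set)"
    and "\<exists>m1\<ge>1. \<exists>m2\<ge>1. \<exists>G \<in> unique_CE_boundary m1 m2.
      finite (nash_equilibria m1 m2 G) \<and> card (nash_equilibria m1 m2 G) > 1"
    and "\<exists>m1\<ge>1. \<exists>m2\<ge>1. \<exists>G \<in> unique_CE_boundary m1 m2. \<exists>!\<sigma>. \<sigma> \<in> nash_equilibria m1 m2 G"
    using ex_boundary_continuum_NE ex_boundary_two_NE rps_game_0_in_unique_CE_boundary
      ex1_NE_rps_game_0 by blast+
qed

end
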